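(* Let $\mathfrak H$ be a Krein space and let $\mathfrak L$, $\mathcal H$ be Hilbert spaces. Let $T$ be a closed symmetric linear relation in $\mathfrak H$, let $(\mathfrak L,\Gamma)$ be an isometric boundary pair for $T^+$ with Weyl family $M_\Gamma$, and let $V$ be an isometric relation from the $\widehat J^\circ_{\mathfrak L}$-space $\mathfrak L^2$ to the $\widehat J^\circ_{\mathcal H}$-space $\mathcal H^2$ such that: (a) $\overline{\Gamma^{-1}|_{\operatorname{dom}V}}=\overline\Gamma^{\,-1}|_{\overline{\operatorname{dom}V}}$, and (b) $\overline{\operatorname{dom}V}\,\widehat+\,\operatorname{ran}\overline\Gamma$ is closed, and (c) $\operatorname{mul}V^+\cap\operatorname{dom}\Gamma^+\subseteq\ker\Gamma^+$. Put $\Gamma':=V\Gamma$. Then $(\mathcal H,\Gamma')$ is an isometric boundary pair for $T^+$ with the Weyl family $$M_{\Gamma'}(z)=V(M_\Gamma(z)),\quad z\in\mathbb C_*.$$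
   Context: Linear relations: a relation from a linear space $X$ to a linear space $Y$ is a linear subset $R\subseteq X\times Y$ (a relation in $X$ if $X=Y$); operators are identified with their graphs. $\operatorname{dom}R,\operatorname{ran}R$ are the domain and range, $\ker R=\{x:(x,0)\in R\}$, $\operatorname{mul}R=\{y:(0,y)\in R\}$, $R^{-1}=\{(y,x):(x,y)\in R\}$, $R(S)=\{y:\exists x\in S,\ (x,y)\in R\}$, $R|_S=R\cap(S\times Y)$, $\overline R$ is the closure; $QR=\{(x,w):\exists y,\ (x,y)\in R,(y,w)\in Q\}$. $\widehat+$ is the componentwise sum, i.e. the sum of linear subsets (here of $\mathfrak L^2$). $\mathbb C_*=\mathbb C\setminus\mathbb R$. Krein space: a Hilbert space $(\mathfrak H,\langle\cdot,\cdot\rangle)$ with a fundamental symmetry $J=J^*=J^{-1}$ and indefinite metric $[f,g]=\langle f,Jg\rangle$. The adjoint of a relation $T$ in $\mathfrak H$ is $T^+=\{(g,g')\in\mathfrak H^2:[f',g]=[f,g']\ \forall(f,f')\in T\}$; $T$ is symmetric if $T\subseteq T^+$. $\mathfrak H^2$ carries the fundamental symmetry $\widehat J_{\mathfrak H}=\begin{pmatrix}0&-iJ\\ iJ&0\end{pmatrix}$; for a Hilbert space $\mathfrak L$, $\mathfrak L^2$ carries $\widehat J^\circ_{\mathfrak L}=\begin{pmatrix}0&-iI\\ iI&0\end{pmatrix}$ (similarly $\mathcal H$). For a relation $R$ between two such spaces, from one with fundamental symmetry $j_1$ to one with fundamental symmetry $j_2$, put $R^+=j_1R^*j_2$ ($R^*$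 the Hilbert space adjoint) and $R_\#=(R^+)^{-1}$; $R$ is isometric if $R\subseteq R_\#$. For a closed symmetric relation $T$ in $\mathfrak H$, $(\mathfrak L,\Gamma)$ with $\Gamma\subseteq\mathfrak H^2\times\mathfrak L^2$ is an isometric boundary pair for $T^+$ if $\Gamma$ is isometric and $T=\ker\Gamma_\#$. Its Weyl family is $M_\Gamma(z)=\{\widehat l\in\mathfrak L^2:\exists f\in\mathfrak H,\ ((f,zf),\widehat l)\in\Gamma\}$, $z\in\mathbb C_*$. The same definitions apply to $(\mathcal H,\Gamma')$. *)

theory Defs
  imports "HOL-Analysis.Analysis" "HOL-Library.Set_Algebras"
begin

text \<open>Complex Hilbert spaces, over the real Hilbert space structure of the library: the norm, the
  topology and completeness are the inherited ones, and the real inner product is the real part of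
  the complex one. The complex inner product is conjugate-linear in its first argument.\<close>

class complex_hilbert_space = real_inner + complete_space +
  fixes scaleC :: "complex \<Rightarrow> 'a \<Rightarrow> 'a"  (infixr \<open>*\<^sub>C\<close> 75)
    and cinner :: "'a \<Rightarrow> 'a \<Rightarrow> complex"  (infix \<open>\<bullet>\<^sub>C\<close> 70)
  assumes scaleC_add_right: "c *\<^sub>C (x + y) = c *\<^sub>C x + c *\<^sub>C y"
    and scaleC_add_left: "(c + d) *\<^sub>C x = c *\<^sub>C x + d *\<^sub>C x"
    and scaleC_scaleC: "c *\<^sub>C d *\<^sub>C x = (c * d) *\<^sub>C x"
    and scaleC_of_real: "complex_of_real r *\<^sub>C x = r *\<^sub>R x"
    and cinner_commute: "x \<bullet>\<^sub>C y = cnj (y \<bullet>\<^sub>C x)"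
    and cinner_add_right: "x \<bullet>\<^sub>C (y + z) = x \<bullet>\<^sub>C y + x \<bullet>\<^sub>C z"
    and cinner_scaleC_right: "x \<bullet>\<^sub>C (c *\<^sub>C y) = c * (x \<bullet>\<^sub>C y)"
    and Re_cinner: "Re (x \<bullet>\<^sub>C y) = inner x y"

instantiation complex :: complex_hilbert_space
begin

definition "c *\<^sub>C (x :: complex) = c * x"
definition "(x :: complex) \<bullet>\<^sub>C y = cnj x * y"

instance
  by standard
    (auto simp: scaleC_complex_def cinner_complex_def algebra_simps inner_complex_def scaleR_conv_of_real)

end

text \<open>The orthogonal sum of two Hilbert spaces.\<close>

instantiation prod :: (complex_hilbert_space, complex_hilbert_space) complex_hilbert_space
begin

definition "c *\<^sub>C (x :: 'a \<times> 'b) = (c *\<^sub>C fst x, c *\<^sub>C snd x)"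
definition "(x :: 'a \<times> 'b) \<bullet>\<^sub>C y = fst x \<bullet>\<^sub>C fst y + snd x \<bullet>\<^sub>C snd y"

instance
proof
  fix x y :: "'a \<times> 'b"
  show "x \<bullet>\<^sub>C y = cnj (y \<bullet>\<^sub>C x)"
    by (simp add: cinner_prod_def cinner_commute[of "fst x" "fst y"] cinner_commute[of "snd x" "snd y"])
qed (auto simp: scaleC_prod_def cinner_prod_def inner_prod_def scaleR_prod_def prod_eq_iff
        algebra_simps scaleC_add_right scaleC_add_left scaleC_scaleC scaleC_of_real
        cinner_add_right cinner_scaleC_right Re_cinner)

end

global_interpretation complex_vector: vector_space "scaleC :: complex \<Rightarrow> 'a \<Rightarrow> 'a :: complex_hilbert_space"
  by standard
    (use scaleC_of_real[of 1] in \<open>simp_all add: scaleC_add_right scaleC_add_left scaleC_scaleC\<close>)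

text \<open>
  A relation from \<open>X\<close> to \<open>Y\<close> is a set of pairs. Domain, range, inverse and the image \<open>R(S)\<close> are the
  library's \<open>Domain R\<close>, \<open>Range R\<close>, \<open>R\<inverse>\<close> and \<open>R `` S\<close>. Relational composition \<open>O\<close> is
  diagrammatic: the product \<open>QR\<close> (first \<open>R\<close>, then \<open>Q\<close>) is \<open>R O Q\<close>.
\<close>

definition linear_relation ::
    "('a::complex_hilbert_space \<times> 'b::complex_hilbert_space) set \<Rightarrow> bool"
  where "linear_relation R \<longleftrightarrow> complex_vector.subspace R"

definition ker :: "('a \<times> 'b::zero) set \<Rightarrow> 'a set"
  where "ker R = {x. (x, 0) \<in> R}"

definition mul :: "('a::zero \<times> 'b) set \<Rightarrow> 'b set"
  where "mul R = {y. (0, y) \<in> R}"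

definition restrict_rel :: "('a \<times> 'b) set \<Rightarrow> 'a set \<Rightarrow> ('a \<times> 'b) set"  (infixl \<open>\<restriction>\<close> 100)
  where "R \<restriction> S = R \<inter> (S \<times> UNIV)"

definition graph :: "('a \<Rightarrow> 'b) \<Rightarrow> ('a \<times> 'b) set"
  where "graph f = {(x, f x) |x. True}"

definition hilbert_adjoint ::
    "('a::complex_hilbert_space \<times> 'b::complex_hilbert_space) set \<Rightarrow> ('b \<times> 'a) set"
  where "hilbert_adjoint R = {(y, y'). \<forall>(x, x') \<in> R. x' \<bullet>\<^sub>C y = x \<bullet>\<^sub>C y'}"

definition fundamental_symmetry :: "('h::complex_hilbert_space \<Rightarrow> 'h) \<Rightarrow> bool"
  where "fundamental_symmetry J \<longleftrightarrow> linear_relation (graph J) \<and>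
    graph J = hilbert_adjoint (graph J) \<and> graph J = (graph J)\<inverse>"

definition krein_inner :: "('h::complex_hilbert_space \<Rightarrow> 'h) \<Rightarrow> 'h \<Rightarrow> 'h \<Rightarrow> complex"
  where "krein_inner J f g = f \<bullet>\<^sub>C J g"

definition krein_adjoint ::
    "('h::complex_hilbert_space \<Rightarrow> 'h) \<Rightarrow> ('h \<times> 'h) set \<Rightarrow> ('h \<times> 'h) set"
  where "krein_adjoint J T =
    {(g, g'). \<forall>(f, f') \<in> T. krein_inner J f' g = krein_inner J f g'}"

definition symmetric_rel :: "('h::complex_hilbert_space \<Rightarrow> 'h) \<Rightarrow> ('h \<times> 'h) set \<Rightarrow> bool"
  where "symmetric_rel J T \<longleftrightarrow> T \<subseteq> krein_adjoint J T"

text \<open>The fundamental symmetry of the doubled space, acting on columns; for a Hilbert space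
  take \<open>J = id\<close>.\<close>

definition Jhat :: "('h::complex_hilbert_space \<Rightarrow> 'h) \<Rightarrow> 'h \<times> 'h \<Rightarrow> 'h \<times> 'h"
  where "Jhat J = (\<lambda>(f, f'). ((- \<i>) *\<^sub>C J f', \<i> *\<^sub>C J f))"

text \<open>\<open>R\<^sup>+ = j\<^sub>1 R\<^sup>* j\<^sub>2\<close> and \<open>R\<^sub># = (R\<^sup>+)\<inverse>\<close>.\<close>

definition indef_adjoint ::
    "('a::complex_hilbert_space \<Rightarrow> 'a) \<Rightarrow> ('b::complex_hilbert_space \<Rightarrow> 'b) \<Rightarrow>
      ('a \<times> 'b) set \<Rightarrow> ('b \<times> 'a) set"
  where "indef_adjoint j1 j2 R = graph j2 O hilbert_adjoint R O graph j1"

definition indef_sharp ::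
    "('a::complex_hilbert_space \<Rightarrow> 'a) \<Rightarrow> ('b::complex_hilbert_space \<Rightarrow> 'b) \<Rightarrow>
      ('a \<times> 'b) set \<Rightarrow> ('a \<times> 'b) set"
  where "indef_sharp j1 j2 R = (indef_adjoint j1 j2 R)\<inverse>"

definition isometric_rel ::
    "('a::complex_hilbert_space \<Rightarrow> 'a) \<Rightarrow> ('b::complex_hilbert_space \<Rightarrow> 'b) \<Rightarrow>
      ('a \<times> 'b) set \<Rightarrow> bool"
  where "isometric_rel j1 j2 R \<longleftrightarrow> R \<subseteq> indef_sharp j1 j2 R"

text \<open>\<open>(\<LL>, \<Gamma>)\<close> is an isometric boundary pair for \<open>T\<^sup>+\<close>, where \<open>\<LL>\<close> is the type \<open>'l\<close>. Meaningful
  for a closed symmetric \<open>T\<close>.\<close>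

definition isometric_boundary_pair ::
    "('h::complex_hilbert_space \<Rightarrow> 'h) \<Rightarrow> ('h \<times> 'h) set \<Rightarrow>
      (('h \<times> 'h) \<times> ('l::complex_hilbert_space \<times> 'l)) set \<Rightarrow> bool"
  where "isometric_boundary_pair J T \<Gamma> \<longleftrightarrow> linear_relation \<Gamma> \<and>
    isometric_rel (Jhat J) (Jhat id) \<Gamma> \<and> T = ker (indef_sharp (Jhat J) (Jhat id) \<Gamma>)"

definition weyl_family ::
    "(('h::complex_hilbert_space \<times> 'h) \<times> ('l \<times> 'l)) set \<Rightarrow> complex \<Rightarrow> ('l \<times> 'l) set"
  where "weyl_family \<Gamma> z = {l. \<exists>f. ((f, z *\<^sub>C f), l) \<in> \<Gamma>}"

end

theory Submission
  imports Defs
begin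

text \<open>
  The kernel of \<open>R\<^sub>#\<close> is the \<open>j\<^sub>1\<close>-orthogonal companion of \<open>dom R\<close>, so the point is
  that passing from \<open>dom \<Gamma>\<close> to \<open>dom (V\<Gamma>) = \<Gamma>\<inverse>(dom V)\<close> does not enlarge the orthogonal complement.
  If \<open>x\<close> is (Hilbert space) orthogonal to \<open>dom (V\<Gamma>)\<close>, then by (a) the pair \<open>(x, 0)\<close> is orthogonal to \<open>A \<inter> B\<close>, where
  \<open>A\<close> is the closure of \<open>\<Gamma>\<close> and \<open>B\<close> is the product of the whole space with the closure of \<open>dom V\<close>.
  By (b) the sum \<open>A + B\<close> is closed, hence \<open>(x, 0)\<close> is a sum of elements of the orthogonal complements
  of \<open>A\<close> and \<open>B\<close>. The second has the form \<open>(0, u)\<close> with \<open>u\<close> orthogonal to \<open>dom V\<close>; so \<open>u\<close>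
  corresponds to an element of \<open>mul V\<^sup>+ \<inter> dom \<Gamma>\<^sup>+\<close>, and (c) forces \<open>x\<close> to be orthogonal to \<open>dom \<Gamma>\<close>.
  All Hilbert space arguments take place in the underlying real inner product: for complex subspaces
  real and complex orthogonality agree.
\<close>

section \<open>Real Hilbert space tools: Riesz vectors, open mapping, orthogonal complements\<close>

text \<open>By the parallelogram law a minimizing sequence of the quadratic functional
  \<open>q\<close> is Cauchy, and the first variation at its limit vanishes. Linearity of
  \<open>\<phi>\<close> is asked on \<open>M\<close> alone because the lemma is applied to a
  functional on \<open>A + B\<close> that is defined by choice.\<close>

lemma riesz_representation_closed_subspace:
  fixes M :: "'a::{real_inner,banach} set" and \<phi> :: "'a \<Rightarrow> real"
  assumes M: "subspace M" "closed M"
    and add: "\<And>x y. x \<in> M \<Longrightarrow> y \<in> M \<Longrightarrow> \<phi> (x + y) = \<phi> x + \<phi> y"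
    and scale: "\<And>c x. x \<in> M \<Longrightarrow> \<phi> (c *\<^sub>R x) = c * \<phi> x"
    and bound: "\<And>x. x \<in> M \<Longrightarrow> \<bar>\<phi> x\<bar> \<le> C * norm x"
  obtains u where "u \<in> M" "\<And>x. x \<in> M \<Longrightarrow> inner x u = \<phi> x"
proof -
  \<comment> \<open>The representing vector is the minimizer of \<open>q\<close> on \<open>M\<close>.\<close>
  define q where "q x = inner x x - 2 * \<phi> x" for x
  define m where "m = Inf (q ` M)"
  have q_bound: "q x \<ge> - C\<^sup>2" if "x \<in> M" for x
  proof -
    have "0 \<le> (norm x - C)\<^sup>2" by simp
    also have "\<dots> = (norm x)\<^sup>2 - 2 * (C * norm x) + C\<^sup>2"
      by (simp add: power2_eq_square algebra_simps)
    finally show ?thesis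
      using bound[OF that] by (auto simp: q_def power2_norm_eq_inner)
  qed
  have bdd: "bdd_below (q ` M)"
    using q_bound by (auto simp: bdd_below_def)
  have m_le: "m \<le> q x" if "x \<in> M" for x
    unfolding m_def using that bdd by (intro cInf_lower) auto
  have "\<exists>x\<in>M. q x < m + 1 / real (Suc n)" for n
    using cInf_lessD[of "q ` M" "m + 1 / real (Suc n)"] subspace_0[OF M(1)]
    by (auto simp: m_def)
  then obtain w where w: "\<And>n. w n \<in> M" "\<And>n. q (w n) < m + 1 / real (Suc n)"
    by metis
  \<comment> \<open>The midpoint of \<open>x\<close> and \<open>y\<close> lies in \<open>M\<close>,
    so \<open>m\<close> bounds \<open>q\<close> there from below; the terms with
    \<open>\<phi>\<close> cancel.\<close>
  have parallelogram: "(norm (x - y))\<^sup>2 \<le> 2 * (q x - m) + 2 * (q y - m)" if "x \<in> M" "y \<in> M" for x y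
  proof -
    have "m \<le> q ((1/2) *\<^sub>R (x + y))"
      using that M by (intro m_le) (simp add: subspace_add subspace_scale)
    moreover have "\<phi> ((1/2) *\<^sub>R (x + y)) = (\<phi> x + \<phi> y) / 2"
      using that M scale[of "x + y" "1/2"] add by (simp add: subspace_add)
    ultimately show ?thesis
      by (simp add: q_def power2_norm_eq_inner inner_simps inner_commute[of y x] field_simps)
  qed
  have "Cauchy w"
  proof (rule metric_CauchyI)
    fix e :: real assume "e > 0"
    then obtain n0 where n0: "4 / e\<^sup>2 < real n0"
      using reals_Archimedean2 by blast
    have "dist (w i) (w j) < e" if ij: "i \<ge> n0" "j \<ge> n0" for i j
    proof -
      have *: "q (w k) - m < e\<^sup>2 / 4" if "k \<ge> n0" for k
      proof -
        have "4 / e\<^sup>2 < real (Suc k)" using n0 that by simp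
        then have "1 / real (Suc k) < e\<^sup>2 / 4"
          using \<open>e > 0\<close> by (simp add: field_simps)
        with w(2)[of k] show ?thesis by linarith
      qed
      have "(norm (w i - w j))\<^sup>2 < e\<^sup>2"
        using parallelogram[OF w(1) w(1), of i j] *[OF ij(1)] *[OF ij(2)] by (simp add: field_simps)
      then show ?thesis
        using \<open>e > 0\<close> by (simp add: dist_norm power2_less_imp_less)
    qed
    then show "\<exists>n0. \<forall>i\<ge>n0. \<forall>j\<ge>n0. dist (w i) (w j) < e" by blast
  qed
  then obtain u where u: "w \<longlonglongrightarrow> u"
    using Cauchy_convergent convergent_def by blast
  have uM: "u \<in> M"
    using closed_sequentially[OF M(2)] w(1) u by blast
  have "(\<lambda>n. \<phi> (w n) - \<phi> u) \<longlonglongrightarrow> 0"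
  proof (rule Lim_null_comparison)
    show "\<forall>\<^sub>F n in sequentially. norm (\<phi> (w n) - \<phi> u) \<le> C * norm (w n - u)"
    proof (intro always_eventually allI)
      fix n
      have "\<phi> (w n) = \<phi> (w n - u) + \<phi> u"
        using add[of "w n - u" u] uM w(1) M by (simp add: subspace_diff)
      then show "norm (\<phi> (w n) - \<phi> u) \<le> C * norm (w n - u)"
        using bound[of "w n - u"] uM w(1) M by (simp add: subspace_diff)
    qed
    show "(\<lambda>n. C * norm (w n - u)) \<longlonglongrightarrow> 0"
      using u by (auto intro!: tendsto_eq_intros simp: LIM_zero_iff)
  qed
  then have "(\<lambda>n. \<phi> (w n)) \<longlonglongrightarrow> \<phi> u" by (simp add: LIM_zero_iff)
  then have "(\<lambda>n. q (w n)) \<longlonglongrightarrow> q u"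
    unfolding q_def using u by (intro tendsto_intros)
  moreover have "(\<lambda>n. m + 1 / real (Suc n)) \<longlonglongrightarrow> m"
    using tendsto_add[OF tendsto_const LIMSEQ_inverse_real_of_nat, of m]
    by (simp add: inverse_eq_divide)
  ultimately have qu: "q u \<le> m"
    using w(2) by (intro LIMSEQ_le) (auto intro: less_imp_le)
  have "inner x u = \<phi> x" if x: "x \<in> M" for x
  proof (rule ccontr)
    define d where "d = inner x u - \<phi> x"
    assume "inner x u \<noteq> \<phi> x"
    then have d: "d \<noteq> 0" by (simp add: d_def)
    \<comment> \<open>The value \<open>t\<close> below minimizes
      \<open>2 * t * d + t\<^sup>2 * s\<close>. Adding 1 makes \<open>s\<close> positive without a
      case split on \<open>x = 0\<close>, and the correction \<open>- t\<^sup>2\<close> has the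
      helpful sign.\<close>
    define s where "s = inner x x + 1"
    have s: "s > 0" unfolding s_def by (intro add_nonneg_pos) simp_all
    define t where "t = - d / s"
    have "q u \<le> q (u + t *\<^sub>R x)"
      using qu m_le[of "u + t *\<^sub>R x"] uM x M by (simp add: subspace_add subspace_scale)
    also have "\<dots> = q u + 2 * t * d + t\<^sup>2 * inner x x"
      using add[of u "t *\<^sub>R x"] scale[of x t] uM x M
      by (simp add: q_def d_def subspace_scale inner_simps inner_commute[of u x] power2_eq_square algebra_simps)
    also have "\<dots> = q u + (2 * t * d + t\<^sup>2 * s) - t\<^sup>2"
      by (simp add: s_def algebra_simps)
    also have "2 * t * d + t\<^sup>2 * s = - d\<^sup>2 / s"
      using s by (simp add: t_def power2_eq_square field_simps)
    finally have "d\<^sup>2 / s + t\<^sup>2 \<le> 0" by simp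
    moreover have "d\<^sup>2 / s > 0" using d s by simp
    ultimately show False using zero_le_power2[of t] by linarith
  qed
  with uM show thesis using that by blast
qed

text \<open>By Baire, the closure of the image of some ball in \<open>X\<close> has interior
  relative to the closed image of \<open>X\<close>. This yields approximate preimages with error at
  most half the norm, and iteration makes them exact while keeping a linear bound.\<close>

lemma open_mapping_preimage_bound:
  fixes f :: "'a::banach \<Rightarrow> 'b::banach"
  assumes f: "bounded_linear f" and X: "subspace X" "closed X" and N: "closed (f ` X)"
  obtains C where "\<And>y. y \<in> f ` X \<Longrightarrow> \<exists>x\<in>X. f x = y \<and> norm x \<le> C * norm y"
proof -
  interpret f: bounded_linear f by (rule f)
  have subN: "subspace (f ` X)"
    using X(1) f.linear by (simp add: linear_subspace_image)
  define F where "F n = f ` X \<inter> closure (f ` (X \<inter> cball 0 (real n)))" for n :: nat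
  obtain n where n: "top_of_set (f ` X) interior_of F n \<noteq> {}"
  proof (rule ccontr)
    assume "\<not> thesis"
    with that have "\<And>n. top_of_set (f ` X) interior_of F n = {}" by blast
    moreover have "completely_metrizable_space (top_of_set (f ` X))"
      using N by (simp add: completely_metrizable_space_closedin completely_metrizable_space_euclidean)
    moreover have "closedin (top_of_set (f ` X)) (F n)" for n
      unfolding F_def by (intro closedin_closed_Int closed_closure)
    ultimately have "top_of_set (f ` X) interior_of \<Union>(range F) = {}"
      by (intro Baire_category_alt) auto
    moreover have "\<Union>(range F) = f ` X"
    proof -
      have "f x \<in> \<Union>(range F)" if "x \<in> X" for x
      proof -
        obtain k :: nat where "norm x \<le> real k" using real_arch_simple by blast
        then have "f x \<in> F k"
          unfolding F_def using that by (auto intro!: subsetD[OF closure_subset])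
        then show ?thesis by blast
      qed
      then show ?thesis by (auto simp: F_def)
    qed
    ultimately show False
      using subspace_0[OF subN] interior_of_topspace[of "top_of_set (f ` X)"] by simp
  qed
  then obtain U y0 where U: "openin (top_of_set (f ` X)) U" "U \<subseteq> F n" "y0 \<in> U"
    by (auto simp: interior_of_def)
  then obtain r where r: "r > 0" "ball y0 r \<inter> f ` X \<subseteq> F n"
    unfolding openin_contains_ball by blast
  have y0: "y0 \<in> f ` X" using U by (auto simp: F_def)
  \<comment> \<open>Two approximants of norm at most \<open>n\<close> differ by at most
    \<open>2 * n\<close> in norm; division by the \<open>t\<close> chosen below turns this into
    \<open>K * norm y\<close>.\<close>
  define K where "K = 4 * real n / r"
  have K: "K \<ge> 0" using r by (simp add: K_def)
  have approx: "\<exists>x\<in>X. norm x \<le> K * norm y \<and> norm (y - f x) \<le> norm y / 2" if y: "y \<in> f ` X" for y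
  proof (cases "y = 0")
    case True
    then show ?thesis using subspace_0[OF X(1)] by (intro bexI[of _ 0]) (auto simp: f.zero)
  next
    case False
    \<comment> \<open>This puts \<open>y0 + t *\<^sub>R y\<close> at distance \<open>r / 2\<close>
      from \<open>y0\<close>. Subtracting approximants of these two points removes the centre, and
      the two errors \<open>r / 8\<close> add up to \<open>r / 4\<close>, which equals
      \<open>t * norm y / 2\<close>.\<close>
    define t where "t = r / (2 * norm y)"
    have t: "t > 0" using False r by (simp add: t_def)
    have near: "\<exists>x\<in>X. norm x \<le> real n \<and> norm (z - f x) < r / 8" if "z \<in> F n" for z
    proof -
      have "z \<in> closure (f ` (X \<inter> cball 0 (real n)))" using that by (simp add: F_def)
      then obtain v where "v \<in> f ` (X \<inter> cball 0 (real n))" "dist v z < r / 8"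
        using r unfolding closure_approachable by (metis divide_pos_pos zero_less_numeral)
      then show ?thesis by (auto simp: dist_norm norm_minus_commute)
    qed
    have "y0 + t *\<^sub>R y \<in> f ` X"
      using subN y y0 by (simp add: subspace_add subspace_scale)
    moreover have "dist y0 (y0 + t *\<^sub>R y) < r"
      using t r False by (simp add: dist_norm t_def)
    ultimately have "y0 + t *\<^sub>R y \<in> F n" using r by auto
    then obtain a where a: "a \<in> X" "norm a \<le> real n" "norm (y0 + t *\<^sub>R y - f a) < r / 8"
      using near by blast
    obtain b where b: "b \<in> X" "norm b \<le> real n" "norm (y0 - f b) < r / 8"
      using near[of y0] U by blast
    define x where "x = (1 / t) *\<^sub>R (a - b)"
    have "x \<in> X" using a b X by (simp add: x_def subspace_diff subspace_scale)
    moreover have "norm x \<le> K * norm y"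
    proof -
      have "norm (a - b) \<le> 2 * real n"
        using norm_triangle_ineq4[of a b] a b by linarith
      then have "norm x \<le> 2 * real n / t"
        using t by (simp add: x_def divide_right_mono)
      also have "\<dots> = K * norm y" using False r by (simp add: t_def K_def field_simps)
      finally show ?thesis .
    qed
    moreover have "norm (y - f x) \<le> norm y / 2"
    proof -
      have "t *\<^sub>R (y - f x) = (y0 + t *\<^sub>R y - f a) - (y0 - f b)"
        using t by (simp add: x_def f.scaleR f.diff algebra_simps)
      then have "norm (t *\<^sub>R (y - f x)) \<le> norm (y0 + t *\<^sub>R y - f a) + norm (y0 - f b)"
        by (simp only: norm_triangle_ineq4)
      then have "t * norm (y - f x) \<le> r / 4" using t a(3) b(3) by simp
      then have "norm (y - f x) \<le> r / 4 / t" using t by (simp add: field_simps)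
      also have "\<dots> = norm y / 2" using False r by (simp add: t_def field_simps)
      finally show ?thesis .
    qed
    ultimately show ?thesis by blast
  qed
  \<comment> \<open>Applying \<open>approx\<close> to the remainders \<open>\<rho> k\<close> gives an exact preimage as a geometrically convergent series.\<close>
  then obtain g where g: "\<And>y. y \<in> f ` X \<Longrightarrow> g y \<in> X"
      "\<And>y. y \<in> f ` X \<Longrightarrow> norm (g y) \<le> K * norm y"
      "\<And>y. y \<in> f ` X \<Longrightarrow> norm (y - f (g y)) \<le> norm y / 2"
    by metis
  have "\<exists>x\<in>X. f x = y \<and> norm x \<le> 2 * K * norm y" if y: "y \<in> f ` X" for y
  proof -
    define \<rho> where "\<rho> k = ((\<lambda>z. z - f (g z)) ^^ k) y" for k
    have \<rho>_Suc: "\<rho> (Suc k) = \<rho> k - f (g (\<rho> k))" for k by (simp add: \<rho>_def)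
    have \<rho>: "\<rho> k \<in> f ` X \<and> norm (\<rho> k) \<le> norm y * (1/2) ^ k" for k
    proof (induction k)
      case 0
      then show ?case using y by (simp add: \<rho>_def)
    next
      case (Suc k)
      then have "\<rho> (Suc k) \<in> f ` X" using g(1) subN by (simp add: \<rho>_Suc subspace_diff)
      moreover have "norm (\<rho> (Suc k)) \<le> norm (\<rho> k) / 2"
        using g(3) Suc by (simp add: \<rho>_Suc)
      ultimately show ?case using Suc by simp
    qed
    define x where "x = (\<lambda>k. g (\<rho> k))"
    have xX: "x k \<in> X" for k using g(1) \<rho> by (simp add: x_def)
    have norm_x: "norm (x k) \<le> K * norm y * (1/2) ^ k" for k
    proof -
      have "norm (x k) \<le> K * norm (\<rho> k)" using g(2) \<rho> by (simp add: x_def)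
      also have "\<dots> \<le> K * (norm y * (1/2) ^ k)" using \<rho> K by (intro mult_left_mono) auto
      finally show ?thesis by simp
    qed
    have geo: "(\<lambda>k. K * norm y * (1/2) ^ k) sums (2 * K * norm y)"
      using sums_mult[OF geometric_sums[of "1/2::real"], of "K * norm y"] by (simp add: mult_ac)
    have sum_norm: "summable (\<lambda>k. norm (x k))"
      using norm_x by (intro summable_norm_comparison_test[OF _ sums_summable[OF geo]]) blast
    have x_sums: "x sums suminf x" by (rule summable_sums[OF summable_norm_cancel[OF sum_norm]])
    have "suminf x \<in> X"
    proof (rule closed_sequentially[OF X(2)])
      show "sum x {..<k} \<in> X" for k using X(1) xX by (simp add: subspace_sum)
      show "(\<lambda>k. sum x {..<k}) \<longlonglongrightarrow> suminf x" using x_sums by (simp add: sums_def)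
    qed
    moreover have "norm (suminf x) \<le> 2 * K * norm y"
      using summable_norm[OF sum_norm] suminf_le[OF norm_x sum_norm] geo
      by (simp add: sums_iff)
    moreover have "f (suminf x) = y"
    proof -
      have "\<rho> \<longlonglongrightarrow> 0"
      proof (rule Lim_null_comparison)
        show "\<forall>\<^sub>F k in sequentially. norm (\<rho> k) \<le> norm y * (1/2) ^ k" using \<rho> by simp
        show "(\<lambda>k. norm y * (1/2) ^ k) \<longlonglongrightarrow> 0"
         by (intro tendsto_mult_right_zero LIMSEQ_realpow_zero) auto
      qed
      \<comment> \<open>Each \<open>f (x k)\<close> is \<open>\<rho> k - \<rho> (Suc k)\<close>, so
        the series telescopes to \<open>\<rho> 0 = y\<close>.\<close>
      then have "(\<lambda>k. f (x k)) sums y"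
        using telescope_sums'[of \<rho> 0] by (simp add: \<rho>_Suc x_def) (simp add: \<rho>_def)
      then show ?thesis using f.sums[OF x_sums] sums_unique2 by blast
    qed
    ultimately show ?thesis by blast
  qed
  then show thesis using that by blast
qed

text \<open>The functional sending \<open>a + b\<close> to \<open>inner a x\<close> is bounded on
  \<open>A + B\<close>, since the open mapping bound supplies decompositions of controlled norm;
  \<open>u\<close> is its Riesz vector. Thus \<open>x = (x - u) + u\<close> splits \<open>x\<close>
  along the orthogonal complements of \<open>A\<close> and \<open>B\<close>.\<close>

lemma orthogonal_Int_decomposition:
  fixes A B :: "'a::{real_inner,banach} set"
  assumes A: "subspace A" "closed A" and B: "subspace B" "closed B" and "closed (A + B)"
    and x: "\<And>z. z \<in> A \<inter> B \<Longrightarrow> inner z x = 0"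
  obtains u where "\<And>a. a \<in> A \<Longrightarrow> inner a u = inner a x" "\<And>b. b \<in> B \<Longrightarrow> inner b u = 0"
proof -
  define s :: "'a \<times> 'a \<Rightarrow> 'a" where "s = (\<lambda>p. fst p + snd p)"
  have s: "bounded_linear s"
    unfolding s_def by (intro bounded_linear_add bounded_linear_fst bounded_linear_snd)
  have img: "s ` (A \<times> B) = A + B"
    by (force simp: s_def set_plus_def)
  have subAB: "subspace (A \<times> B)" using A B by (simp add: subspace_Times)
  have sub: "subspace (A + B)"
    unfolding img[symmetric] using subAB s bounded_linear.linear linear_subspace_image by blast
  obtain C where C: "\<And>y. y \<in> A + B \<Longrightarrow> \<exists>p\<in>A \<times> B. s p = y \<and> norm p \<le> C * norm y"
    using open_mapping_preimage_bound[OF s subAB] assms by (auto simp: closed_Times img)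
  \<comment> \<open>\<open>\<phi> (a + b) = inner a x\<close> does not depend on the decomposition, since \<open>x\<close> annihilates \<open>A \<inter> B\<close>.\<close>
  define \<phi> where "\<phi> y = inner (SOME a. a \<in> A \<and> y - a \<in> B) x" for y
  have \<phi>: "\<phi> (a + b) = inner a x" if "a \<in> A" "b \<in> B" for a b
  proof -
    define a' where "a' = (SOME c. c \<in> A \<and> a + b - c \<in> B)"
    have a': "a' \<in> A \<and> a + b - a' \<in> B"
      unfolding a'_def by (rule someI[of _ a]) (use that in simp)
    then have "a - a' \<in> A" using A that by (simp add: subspace_diff)
    moreover have "a - a' \<in> B"
      using subspace_diff[OF B(1), of "a + b - a'" b] a' that by simp
    ultimately have "inner (a - a') x = 0" using x by blast
    then show ?thesis by (simp add: \<phi>_def a'_def inner_diff_left)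
  qed
  obtain u where u: "\<And>y. y \<in> A + B \<Longrightarrow> inner y u = \<phi> y"
  proof (rule riesz_representation_closed_subspace[OF sub \<open>closed (A + B)\<close>, of \<phi> "C * norm x"])
    fix y z assume "y \<in> A + B" "z \<in> A + B"
    then obtain a b c d where *: "a \<in> A" "b \<in> B" "y = a + b" "c \<in> A" "d \<in> B" "z = c + d"
      by (auto simp: set_plus_def)
    then show "\<phi> (y + z) = \<phi> y + \<phi> z"
      using \<phi>[of "a + c" "b + d"] A B by (simp add: \<phi> subspace_add inner_simps add_ac)
  next
    fix c y assume "y \<in> A + B"
    then obtain a b where "a \<in> A" "b \<in> B" "y = a + b" by (auto simp: set_plus_def)
    then show "\<phi> (c *\<^sub>R y) = c * \<phi> y"
      using \<phi>[of "c *\<^sub>R a" "c *\<^sub>R b"] A B by (simp add: \<phi> subspace_scale scaleR_add_right)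
  next
    fix y assume "y \<in> A + B"
    then obtain a b where ab: "a \<in> A" "b \<in> B" "y = a + b" "norm (a, b) \<le> C * norm y"
      using C by (force simp: s_def)
    then have "\<bar>\<phi> y\<bar> \<le> norm a * norm x" by (simp add: \<phi> Cauchy_Schwarz_ineq2)
    also have "\<dots> \<le> C * norm y * norm x" using ab(4) norm_fst_le[of a b] by (intro mult_right_mono) auto
    finally show "\<bar>\<phi> y\<bar> \<le> C * norm x * norm y" by (simp add: mult_ac)
  qed blast
  show thesis
  proof (rule that)
    show "inner a u = inner a x" if "a \<in> A" for a
      using u[of "a + 0"] \<phi>[of a 0] that subspace_0[OF B(1)] set_plus_intro[of a A 0 B] by simp
    show "inner b u = 0" if "b \<in> B" for b
      using u[of "0 + b"] \<phi>[of 0 b] that subspace_0[OF A(1)] set_plus_intro[of 0 A b B] by simp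
  qed
qed

section \<open>Complex subspaces seen in the real structure\<close>

instance complex_hilbert_space \<subseteq> banach ..

lemma subspace_imp_real_subspace:
  "complex_vector.subspace S \<Longrightarrow> subspace S"
  by (metis complex_vector.subspace_def scaleC_of_real subspace_def)

lemma subspace_closure:
  fixes S :: "'a::real_normed_vector set"
  assumes "subspace S"
  shows "subspace (closure S)"
proof (rule subspaceI)
  show "0 \<in> closure S"
    using assms closure_subset subspace_0 by blast
  show "x + y \<in> closure S" if xy: "x \<in> closure S" "y \<in> closure S" for x y
  proof -
    obtain v w where "\<And>n. v n \<in> S" "v \<longlonglongrightarrow> x" "\<And>n. w n \<in> S" "w \<longlonglongrightarrow> y"
      using xy unfolding closure_sequential by blast
    then show ?thesis
      using assms unfolding closure_sequential
      by (intro exI[of _ "\<lambda>n. v n + w n"]) (auto intro: tendsto_add subspace_add)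
  qed
  show "c *\<^sub>R x \<in> closure S" if x: "x \<in> closure S" for c x
  proof -
    obtain v where "\<And>n. v n \<in> S" "v \<longlonglongrightarrow> x"
      using x unfolding closure_sequential by blast
    then show ?thesis
      using assms unfolding closure_sequential
      by (intro exI[of _ "\<lambda>n. c *\<^sub>R v n"]) (auto intro: tendsto_intros subspace_scale)
  qed
qed

text \<open>The multiple \<open>\<i> *\<^sub>C x\<close> also lies in \<open>S\<close>, and its real
  inner product with \<open>u\<close> recovers the imaginary part up to sign.\<close>

lemma cinner_eq_0_if_inner_eq_0:
  assumes "complex_vector.subspace S" "\<And>s. s \<in> S \<Longrightarrow> inner s u = 0" "x \<in> S"
  shows "x \<bullet>\<^sub>C u = 0"
proof -
  have "Re (u \<bullet>\<^sub>C (c *\<^sub>C x)) = 0" for c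
    using assms complex_vector.subspace_scale[OF assms(1,3), of c]
    by (simp add: Re_cinner inner_commute[of u])
  from this[of 1] this[of \<i>] have "u \<bullet>\<^sub>C x = 0"
    by (simp add: complex_eq_iff cinner_scaleC_right)
  then show ?thesis by (subst cinner_commute) simp
qed

lemma cinner_zero_right [simp]: "x \<bullet>\<^sub>C 0 = 0"
  using cinner_scaleC_right[of x 0 0] by simp

lemma cinner_minus_right: "x \<bullet>\<^sub>C (- y) = - (x \<bullet>\<^sub>C y)"
  using cinner_scaleC_right[of x "-1" y] by simp

section \<open>Linear relations, indefinite adjoints and isometry\<close>

lemma linear_relation_relcomp:
  assumes "linear_relation R" "linear_relation S"
  shows "linear_relation (R O S)"
proof -
  have add: "(x + y, x' + y') \<in> Q" if "linear_relation Q" "(x, x') \<in> Q" "(y, y') \<in> Q"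
    for Q :: "('x::complex_hilbert_space \<times> 'y::complex_hilbert_space) set" and x x' y y'
    using complex_vector.subspace_add that unfolding linear_relation_def by fastforce
  have scale: "(c *\<^sub>C x, c *\<^sub>C x') \<in> Q" if "linear_relation Q" "(x, x') \<in> Q"
    for Q :: "('x::complex_hilbert_space \<times> 'y::complex_hilbert_space) set" and c x x'
    using complex_vector.subspace_scale[of Q "(x, x')" c] that
    by (simp add: linear_relation_def scaleC_prod_def)
  have zero: "(0, 0) \<in> Q" if "linear_relation Q"
    for Q :: "('x::complex_hilbert_space \<times> 'y::complex_hilbert_space) set"
    using complex_vector.subspace_0[of Q] that by (simp add: linear_relation_def zero_prod_def)
  show ?thesis
    unfolding linear_relation_def
  proof (rule complex_vector.subspaceI)
    show "0 \<in> R O S"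
      using zero[OF assms(1)] zero[OF assms(2)] by (auto simp: zero_prod_def)
    show "p + q \<in> R O S" if "p \<in> R O S" "q \<in> R O S" for p q
      using that add[OF assms(1)] add[OF assms(2)] by (cases p; cases q) (auto, blast intro: relcompI)
    show "c *\<^sub>C p \<in> R O S" if "p \<in> R O S" for c p
      using that scale[OF assms(1)] scale[OF assms(2)]
      by (cases p) (auto simp: scaleC_prod_def, blast intro: relcompI)
  qed
qed

lemma linear_relation_Domain:
  assumes "linear_relation R"
  shows "complex_vector.subspace (Domain R)"
proof (rule complex_vector.subspaceI)
  note R = assms[unfolded linear_relation_def]
  show "0 \<in> Domain R"
    using complex_vector.subspace_0[OF R] by (auto simp: zero_prod_def)
  show "x + y \<in> Domain R" if "x \<in> Domain R" "y \<in> Domain R" for x y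
    using that complex_vector.subspace_add[OF R] by fastforce
  show "c *\<^sub>C x \<in> Domain R" if "x \<in> Domain R" for c x
    using that complex_vector.subspace_scale[OF R, of _ c] by (fastforce simp: scaleC_prod_def)
qed

text \<open>As \<open>j1\<close> is its own inverse, it can be moved across the last factor of the
  product, leaving a Green-type identity as the working form of the adjoint.\<close>

lemma mem_indef_adjoint:
  assumes "\<And>x. j1 (j1 x) = x"
  shows "(y, x) \<in> indef_adjoint j1 j2 R \<longleftrightarrow> (\<forall>(f, f') \<in> R. f' \<bullet>\<^sub>C j2 y = f \<bullet>\<^sub>C j1 x)"
proof -
  have "x = j1 z \<longleftrightarrow> z = j1 x" for z using assms by metis
  then show ?thesis
    by (auto simp: indef_adjoint_def graph_def relcomp_unfold hilbert_adjoint_def)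
qed

lemma isometric_rel_iff:
  assumes "\<And>x. j1 (j1 x) = x"
  shows "isometric_rel j1 j2 R \<longleftrightarrow>
    (\<forall>(g, g') \<in> R. \<forall>(f, f') \<in> R. f' \<bullet>\<^sub>C j2 g' = f \<bullet>\<^sub>C j1 g)"
  unfolding isometric_rel_def indef_sharp_def subset_iff split_paired_All Ball_def converse_iff
    mem_indef_adjoint[of j1, OF assms] by auto

text \<open>The Green identities of \<open>R\<close> and \<open>S\<close> share the
  \<open>j2\<close> form of the intermediate elements, so they chain.\<close>

lemma isometric_rel_relcomp:
  assumes "\<And>x. j1 (j1 x) = x" "\<And>x. j2 (j2 x) = x"
    and "isometric_rel j1 j2 R" "isometric_rel j2 j3 S"
  shows "isometric_rel j1 j3 (R O S)"
  using assms(3,4) unfolding isometric_rel_iff[of j1, OF assms(1)] isometric_rel_iff[of j2, OF assms(2)]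
  by fastforce

lemma mem_ker_indef_sharp:
  assumes "\<And>x. j1 (j1 x) = x" "j2 0 = 0"
  shows "x \<in> ker (indef_sharp j1 j2 R) \<longleftrightarrow> (\<forall>f \<in> Domain R. f \<bullet>\<^sub>C j1 x = 0)"
  by (force simp: ker_def indef_sharp_def mem_indef_adjoint[of j1, OF assms(1)] assms(2))

lemma fundamental_symmetry_involution:
  assumes "fundamental_symmetry J"
  shows "J (J x) = x"
proof -
  have "(x, J x) \<in> (graph J)\<inverse>" using assms by (auto simp: fundamental_symmetry_def graph_def)
  then show ?thesis by (simp add: graph_def)
qed

lemma fundamental_symmetry_scaleC:
  assumes "fundamental_symmetry J"
  shows "J (c *\<^sub>C x) = c *\<^sub>C J x"
proof -
  have "c *\<^sub>C (x, J x) \<in> graph J"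
    using assms complex_vector.subspace_scale
    by (fastforce simp: fundamental_symmetry_def linear_relation_def graph_def)
  then show ?thesis by (simp add: graph_def scaleC_prod_def)
qed

lemma Jhat_involution:
  assumes "fundamental_symmetry J"
  shows "Jhat J (Jhat J x) = x"
  by (cases x) (simp add: Jhat_def fundamental_symmetry_scaleC[OF assms]
      fundamental_symmetry_involution[OF assms] scaleC_scaleC del: complex_vector.scale_minus_left)

lemma Jhat_id_involution: "Jhat id (Jhat id x) = x"
  by (cases x) (simp add: Jhat_def scaleC_scaleC)

lemma Jhat_id_zero: "Jhat id 0 = 0"
  by (simp add: Jhat_def zero_prod_def)

lemma Jhat_zero:
  assumes "fundamental_symmetry J"
  shows "Jhat J 0 = 0"
  using fundamental_symmetry_scaleC[OF assms, of 0 0] by (simp add: Jhat_def zero_prod_def)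

section \<open>Kernels under composition of relations\<close>

text \<open>One inclusion holds because the domain of \<open>R O V\<close> lies in that of
  \<open>R\<close>. The converse splits \<open>(j1 x, 0)\<close> orthogonally in the product
  space.\<close>

lemma ker_indef_sharp_relcomp:
  fixes R :: "('a::complex_hilbert_space \<times> 'b::complex_hilbert_space) set"
    and V :: "('b \<times> 'c::complex_hilbert_space) set"
  assumes j: "\<And>x. j1 (j1 x) = x" "\<And>x. j2 (j2 x) = x" "j1 0 = 0" "j2 0 = 0" "j3 0 = 0"
    and lin: "linear_relation R" "linear_relation V"
    and a: "closure (R\<inverse> \<restriction> Domain V) = (closure R)\<inverse> \<restriction> closure (Domain V)"
    and b: "closed (closure (Domain V) + Range (closure R))"
    and c: "mul (indef_adjoint j2 j3 V) \<inter> Domain (indef_adjoint j1 j2 R) \<subseteq> ker (indef_adjoint j1 j2 R)"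
  shows "ker (indef_sharp j1 j3 (R O V)) = ker (indef_sharp j1 j2 R)"
proof
  show "ker (indef_sharp j1 j2 R) \<subseteq> ker (indef_sharp j1 j3 (R O V))"
    by (auto 0 3 simp: mem_ker_indef_sharp[of j1, OF j(1)] j)
next
  define D where "D = closure (Domain V)"
  have D: "subspace D" "closed D" and R: "subspace (closure R)"
    using lin linear_relation_Domain[of V]
    by (auto simp: D_def linear_relation_def subspace_imp_real_subspace intro!: subspace_closure)
  show "ker (indef_sharp j1 j3 (R O V)) \<subseteq> ker (indef_sharp j1 j2 R)"
  proof
    fix x assume x: "x \<in> ker (indef_sharp j1 j3 (R O V))"
    \<comment> \<open>This \<open>A\<close> is the set called \<open>B\<close> in the opening
      overview; \<open>closure R\<close> has the role of the other subspace.\<close>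
    define A where "A = (UNIV :: 'a set) \<times> D"
    have A: "subspace A" "closed A"
      using D by (auto simp: A_def subspace_Times subspace_UNIV closed_Times)
    \<comment> \<open>The first component of \<open>A\<close> is free, so only the second components
      restrict the sum; this brings it into the form covered by \<open>b\<close>.\<close>
    have sum_eq: "closure R + A = (UNIV :: 'a set) \<times> (D + Range (closure R))"
    proof (intro equalityI subsetI)
      fix p assume "p \<in> closure R + A"
      then show "p \<in> (UNIV :: 'a set) \<times> (D + Range (closure R))"
        by (auto simp: A_def set_plus_def) (metis Range.intros add.commute)
    next
      fix p assume "p \<in> (UNIV :: 'a set) \<times> (D + Range (closure R))"
      then obtain f d h l where p: "p = (f, d + l)" "d \<in> D" "(h, l) \<in> closure R"
        by (auto simp: set_plus_def)
      then have "p = (h, l) + (f - h, d)" "(f - h, d) \<in> A"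
        by (auto simp: A_def add.commute)
      with p show "p \<in> closure R + A" by (metis set_plus_intro)
    qed
    have "closed (closure R + A)"
      unfolding sum_eq using b by (simp add: D_def closed_Times)
    \<comment> \<open>By \<open>a\<close>, the swapped pair is a limit of pairs whose second
      component lies in the domain of \<open>R O V\<close>, where orthogonality to
      \<open>j1 x\<close> is known; continuity carries it over.\<close>
    moreover have "inner p (j1 x, 0) = 0" if "p \<in> closure R \<inter> A" for p
    proof -
      obtain h l where p: "p = (h, l)" by fastforce
      have "(l, h) \<in> closure (R\<inverse> \<restriction> Domain V)"
        using that unfolding a by (auto simp: p A_def D_def restrict_rel_def)
      then have "inner (snd (l, h)) (j1 x) = 0"
      proof (rule continuous_constant_on_closure[rotated 2])
        show "continuous_on (closure (R\<inverse> \<restriction> Domain V)) (\<lambda>q. inner (snd q) (j1 x))"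
         by (intro continuous_intros)
        fix q assume "q \<in> R\<inverse> \<restriction> Domain V"
        then have "snd q \<in> Domain (R O V)" by (force simp: restrict_rel_def)
        then have "snd q \<bullet>\<^sub>C j1 x = 0"
          using x by (simp add: mem_ker_indef_sharp[of j1, OF j(1)] j)
        then show "inner (snd q) (j1 x) = 0" by (simp flip: Re_cinner)
      qed
      then show ?thesis by (simp add: p)
    qed
    ultimately obtain w where w: "\<And>p. p \<in> closure R \<Longrightarrow> inner p w = inner p (j1 x, 0)"
        "\<And>p. p \<in> A \<Longrightarrow> inner p w = 0"
      using orthogonal_Int_decomposition[OF R closed_closure A] by metis
    obtain v u where vu: "w = (v, u)" by fastforce
    \<comment> \<open>The pair \<open>(v, 0)\<close> itself belongs to \<open>A\<close>, so
      \<open>v\<close> is orthogonal to itself. Hence \<open>w - (j1 x, 0)\<close> is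
      \<open>(- j1 x, u)\<close>.\<close>
    have "v = 0"
      using w(2)[of "(v, 0)"] subspace_0[OF D(1)] by (simp add: vu A_def)
    have "inner p (- j1 x, u) = 0" if "p \<in> R" for p
      using w(1)[of p] that closure_subset[of R] by (cases p) (auto simp: vu \<open>v = 0\<close>)
    then have "p \<bullet>\<^sub>C (- j1 x, u) = 0" if "p \<in> R" for p
      using that lin(1) cinner_eq_0_if_inner_eq_0 unfolding linear_relation_def by blast
    then have "(j2 u, x) \<in> indef_adjoint j1 j2 R"
      by (fastforce simp: mem_indef_adjoint[of j1, OF j(1)] j cinner_prod_def cinner_minus_right)
    moreover have "j2 u \<in> mul (indef_adjoint j2 j3 V)"
    proof -
      have "inner l u = 0" if "l \<in> Domain V" for l
        using w(2)[of "(0, l)"] that closure_subset[of "Domain V"] by (auto simp: vu A_def D_def)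
      then have "l \<bullet>\<^sub>C u = 0" if "l \<in> Domain V" for l
        using that lin(2) linear_relation_Domain cinner_eq_0_if_inner_eq_0 by blast
      then show ?thesis
        by (force simp: mul_def mem_indef_adjoint[of j2, OF j(2)] j)
    qed
    \<comment> \<open>Both \<open>x\<close> and \<open>0\<close> are now adjoint values at
      \<open>j2 u\<close>. Comparing the two Green identities shows \<open>j1 x\<close> orthogonal
      to the domain of \<open>R\<close>.\<close>
    ultimately have "(j2 u, 0) \<in> indef_adjoint j1 j2 R" using c by (auto simp: ker_def)
    with \<open>(j2 u, x) \<in> indef_adjoint j1 j2 R\<close> show "x \<in> ker (indef_sharp j1 j2 R)"
      by (fastforce simp: mem_ker_indef_sharp[of j1, OF j(1)] mem_indef_adjoint[of j1, OF j(1)] j)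
  qed
qed

section \<open>The transformed boundary pair and its Weyl family\<close>

theorem theorem7p1:
  fixes J :: "'h::complex_hilbert_space \<Rightarrow> 'h"
    and T :: "('h \<times> 'h) set"
    and \<Gamma> :: "(('h \<times> 'h) \<times> ('l::complex_hilbert_space \<times> 'l)) set"
    and V :: "(('l \<times> 'l) \<times> ('k::complex_hilbert_space \<times> 'k)) set"
    and \<Gamma>' :: "(('h \<times> 'h) \<times> ('k \<times> 'k)) set"
  assumes J: "fundamental_symmetry J"
    and T: "linear_relation T" "closed T" "symmetric_rel J T"
    and \<Gamma>: "isometric_boundary_pair J T \<Gamma>"
    and V: "linear_relation V" "isometric_rel (Jhat id) (Jhat id) V"
    and a: "closure (\<Gamma>\<inverse> \<restriction> Domain V) = (closure \<Gamma>)\<inverse> \<restriction> closure (Domain V)"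
    and b: "closed (closure (Domain V) + Range (closure \<Gamma>))"
    and c: "mul (indef_adjoint (Jhat id) (Jhat id) V) \<inter> Domain (indef_adjoint (Jhat J) (Jhat id) \<Gamma>)
              \<subseteq> ker (indef_adjoint (Jhat J) (Jhat id) \<Gamma>)"
    and \<Gamma>': "\<Gamma>' = \<Gamma> O V"
  shows "isometric_boundary_pair J T \<Gamma>' \<and>
    (\<forall>z. z \<notin> \<real> \<longrightarrow> weyl_family \<Gamma>' z = V `` weyl_family \<Gamma> z)"
proof -
  have \<Gamma>_pair: "linear_relation \<Gamma>" "isometric_rel (Jhat J) (Jhat id) \<Gamma>"
      "T = ker (indef_sharp (Jhat J) (Jhat id) \<Gamma>)"
    using \<Gamma> by (simp_all add: isometric_boundary_pair_def)
  have "ker (indef_sharp (Jhat J) (Jhat id) \<Gamma>') = T"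
    unfolding \<Gamma>' \<Gamma>_pair(3)
    by (rule ker_indef_sharp_relcomp)
      (use Jhat_involution[OF J] Jhat_id_involution Jhat_zero[OF J] Jhat_id_zero \<Gamma>_pair(1) V(1) a b c in auto)
  moreover have "isometric_rel (Jhat J) (Jhat id) \<Gamma>'"
    unfolding \<Gamma>' using Jhat_involution[OF J] Jhat_id_involution \<Gamma>_pair(2) V(2)
    by (rule isometric_rel_relcomp)
  moreover have "linear_relation \<Gamma>'"
    unfolding \<Gamma>' using \<Gamma>_pair(1) V(1) by (rule linear_relation_relcomp)
  \<comment> \<open>Both sides assert the existence of \<open>f\<close> and of an intermediate
    element of the Weyl family of \<open>\<Gamma>\<close>, only with the quantifiers in a different
    order.\<close>
  moreover have "weyl_family \<Gamma>' z = V `` weyl_family \<Gamma> z" for z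
    by (auto simp: weyl_family_def \<Gamma>')
  ultimately show ?thesis
    by (simp add: isometric_boundary_pair_def)
qed

end
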